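(* (i) For $a\in\mathbb{R}^d$, the linear map $\mathbb{R}^d\to\mathbb{R}$, $x\mapsto\langle a,x\rangle$, is an additive function (a sum of univariate functions of the individual variables), and can be written as a tensor train with ranks $(2,\dots,2)$. (ii) For $A\in\mathbb{R}^{m\times d}$ and $b\in\mathbb{R}^m$, the affine map $\mathbb{R}^d\to\mathbb{R}^m$, $x\mapsto Ax+b$, has a tensor train representation with ranks at most $d$.
   Context: A function $v:\mathbb{R}^d\to\mathbb{R}^m$ has a tensor train (TT) representation with ranks $(r_1,\dots,r_{d-1})$ if there are matrix-valued functions $\hat U_i:\mathbb{R}\to\mathbb{R}^{r_{i-1}\times r_i}$, $1\le i\le d$, with $r_0=m$ and $r_d=1$, such that $v(x)=\hat U_1(x_1)\hat U_2(x_2)\cdots\hat U_d(x_d)$ for all $x\in\mathbb{R}^d$. For vector-valued functions the boundary rank $r_0=m$ is the output dimension and is not counted among the ranks bounded by $d$. The entries of the $\hat U_i$ are taken in a univariate function space containing the constants and the identity function. *)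

theory Defs
  imports "Jordan_Normal_Form.Matrix"
begin

text \<open>
  Vectors in \<open>\<real>\<^sup>d\<close> are elements of \<open>carrier_vec d\<close>; coordinates, like the cores of a tensor train,
  are numbered from 0.
\<close>

text \<open>A linear space of univariate functions containing the constants and the identity.\<close>

definition univariate_space :: "(real \<Rightarrow> real) set \<Rightarrow> bool" where
  "univariate_space F \<longleftrightarrow>
     (\<forall>f\<in>F. \<forall>g\<in>F. (\<lambda>t. f t + g t) \<in> F) \<and>
     (\<forall>c. \<forall>f\<in>F. (\<lambda>t. c * f t) \<in> F) \<and>
     (\<forall>c. (\<lambda>t. c) \<in> F) \<and>
     (\<lambda>t. t) \<in> F"

definition additive_function :: "nat \<Rightarrow> (real vec \<Rightarrow> real) \<Rightarrow> bool" where
  "additive_function d f \<longleftrightarrow>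
     (\<exists>g :: nat \<Rightarrow> real \<Rightarrow> real. \<forall>x\<in>carrier_vec d. f x = (\<Sum>i<d. g i (x $ i)))"

text \<open>
  The product \<open>U\<^sub>0(x\<^sub>0) \<cdots> U\<^sub>d\<^sub>-\<^sub>1(x\<^sub>d\<^sub>-\<^sub>1)\<close>. Its last factor has a single column, so the fold may
  start with the \<open>1 \<times> 1\<close> identity matrix.
\<close>

definition tt_product :: "nat \<Rightarrow> (nat \<Rightarrow> real \<Rightarrow> real mat) \<Rightarrow> real vec \<Rightarrow> real mat" where
  "tt_product d U x = foldr (\<lambda>i M. U i (x $ i) * M) [0..<d] (1\<^sub>m 1)"

text \<open>
  \<open>rs\<close> lists the inner ranks \<open>r\<^sub>1, \<dots>, r\<^sub>d\<^sub>-\<^sub>1\<close>, all positive; the boundary ranks \<open>r\<^sub>0 = m\<close> and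
  \<open>r\<^sub>d = 1\<close> are added to it. The resulting \<open>m \<times> 1\<close> matrix is identified with its only column.
\<close>

definition has_tt_representation ::
  "(real \<Rightarrow> real) set \<Rightarrow> nat \<Rightarrow> nat \<Rightarrow> (real vec \<Rightarrow> real vec) \<Rightarrow> nat list \<Rightarrow> bool" where
  "has_tt_representation F d m v rs \<longleftrightarrow>
     length rs = d - 1 \<and> (\<forall>r\<in>set rs. 1 \<le> r) \<and>
     (\<exists>U :: nat \<Rightarrow> real \<Rightarrow> real mat.
        (\<forall>i<d. \<forall>t. U i t \<in> carrier_mat ((m # rs @ [1]) ! i) ((m # rs @ [1]) ! Suc i)) \<and>
        (\<forall>i<d. \<forall>j<(m # rs @ [1]) ! i. \<forall>k<(m # rs @ [1]) ! Suc i. (\<lambda>t. U i t $$ (j, k)) \<in> F) \<and>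
        (\<forall>x\<in>carrier_vec d. v x = col (tt_product d U x) 0))"

end

theory Submission imports Defs begin

text \<open>
  Splitting off the first \<open>k\<close> coordinates, an affine map depends on the remaining ones only through
  a short column vector \<open>e\<^sub>k\<close>, and the core \<open>U\<^sub>k(x\<^sub>k)\<close> is read off the linear relation
  \<open>e\<^sub>k = U\<^sub>k(x\<^sub>k) e\<^sub>k\<^sub>+\<^sub>1\<close>. For a linear form, \<open>e\<^sub>k = (\<Sum>j\<ge>k. a\<^sub>j x\<^sub>j, 1)\<close>, which gives rank 2. For
  \<open>Ax + b\<close>, \<open>e\<^sub>k = (1, x\<^sub>k, \<dots>, x\<^sub>d\<^sub>-\<^sub>1)\<close> with \<open>k \<ge> 1\<close>, which gives rank \<open>d - k + 1 \<le> d\<close>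
  independently of \<open>m\<close>.
\<close>

text \<open>Multiplying from the right, the product of the cores \<open>i, ..., d - 1\<close> is the
  column \<open>e x i\<close>: \<open>e_last\<close> matches the \<open>1 \<times> 1\<close>
  identity that starts the fold, and \<open>step\<close> is one multiplication by a core.\<close>

lemma has_tt_representation_backward_recursion:
  fixes r :: "nat \<Rightarrow> nat" and u :: "nat \<Rightarrow> real \<Rightarrow> nat \<Rightarrow> nat \<Rightarrow> real"
    and e :: "real vec \<Rightarrow> nat \<Rightarrow> nat \<Rightarrow> real"
  assumes d: "1 \<le> d"
    and r_last: "r d = 1"
    and r_pos: "\<And>i. 1 \<le> i \<Longrightarrow> i < d \<Longrightarrow> 1 \<le> r i"
    and entries: "\<And>i j k. i < d \<Longrightarrow> j < r i \<Longrightarrow> k < r (Suc i) \<Longrightarrow> (\<lambda>t. u i t j k) \<in> F"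
    and e_last: "\<And>x. x \<in> carrier_vec d \<Longrightarrow> e x d 0 = 1"
    and step: "\<And>x i j. x \<in> carrier_vec d \<Longrightarrow> i < d \<Longrightarrow> j < r i \<Longrightarrow>
      (\<Sum>k<r (Suc i). u i (x $ i) j k * e x (Suc i) k) = e x i j"
    and v: "\<And>x. x \<in> carrier_vec d \<Longrightarrow> v x = vec (r 0) (e x 0)"
  shows "has_tt_representation F d (r 0) v (map r [1..<d])"
proof -
  define U where "U i t = mat (r i) (r (Suc i)) (\<lambda>(j, k). u i t j k)" for i t
  have "[0..<d] = 0 # [1..<d]"
    using d by (simp add: upt_conv_Cons)
  \<comment> \<open>Including the boundary ranks in \<open>r\<close> makes indexing uniform:
    \<open>R ! i = r i\<close> for all \<open>i \<le> d\<close>.\<close>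
  define R where "R = r 0 # map r [1..<d] @ [1]"
  have "R = map r [0..<Suc d]"
    using \<open>[0..<d] = 0 # [1..<d]\<close> by (simp add: R_def r_last)
  then have nth: "R ! i = r i" if "i \<le> d" for i
    using that by (simp add: nth_map_upt del: upt_Suc)
  \<comment> \<open>Induction on the number \<open>n\<close> of trailing cores; \<open>n = d\<close>
    gives the full product.\<close>
  have suffix: "foldr (\<lambda>i M. U i (x $ i) * M) [d - n..<d] (1\<^sub>m 1)
      = mat (r (d - n)) 1 (\<lambda>(j, _). e x (d - n) j)"
    if x: "x \<in> carrier_vec d" and "n \<le> d" for x n
    using \<open>n \<le> d\<close>
  proof (induction n)
    case 0
    show ?case by (intro eq_matI) (auto simp: r_last e_last[OF x])
  next
    case (Suc n)
    define i where "i = d - Suc n"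
    have i: "i < d" "d - n = Suc i" using Suc.prems by (auto simp: i_def)
    have "U i (x $ i) * mat (r (Suc i)) 1 (\<lambda>(j, _). e x (Suc i) j)
        = mat (r i) 1 (\<lambda>(j, _). e x i j)"
      using step[OF x i(1)]
      by (intro eq_matI) (auto simp: U_def scalar_prod_def atLeast0LessThan)
    then show ?case
      using Suc i by (simp add: i_def[symmetric] upt_conv_Cons)
  qed
  have "v x = col (tt_product d U x) 0" if "x \<in> carrier_vec d" for x
    using suffix[OF that, of d] v[OF that] by (auto simp: tt_product_def)
  moreover have "U i t \<in> carrier_mat (r i) (r (Suc i))" for i t
    by (simp add: U_def)
  moreover have "(\<lambda>t. U i t $$ (j, k)) \<in> F" if "i < d" "j < r i" "k < r (Suc i)" for i j k
    using entries[OF that] that by (simp add: U_def)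
  ultimately have "\<exists>U :: nat \<Rightarrow> real \<Rightarrow> real mat.
      (\<forall>i<d. \<forall>t. U i t \<in> carrier_mat (r i) (r (Suc i))) \<and>
      (\<forall>i<d. \<forall>j<r i. \<forall>k<r (Suc i). (\<lambda>t. U i t $$ (j, k)) \<in> F) \<and>
      (\<forall>x\<in>carrier_vec d. v x = col (tt_product d U x) 0)"
    by blast
  then show ?thesis
    unfolding has_tt_representation_def R_def[symmetric] using r_pos by (simp add: nth)
qed

lemma univariate_space_const: "univariate_space F \<Longrightarrow> (\<lambda>t. c) \<in> F"
  by (simp add: univariate_space_def)

lemma univariate_space_affine:
  assumes "univariate_space F"
  shows "(\<lambda>t. b + c * t) \<in> F"
  using assms unfolding univariate_space_def by fastforce

lemma additive_function_scalar_prod: "additive_function d (\<lambda>x. a \<bullet> x)"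
  unfolding additive_function_def
  by (rule exI[of _ "\<lambda>i t. a $ i * t"]) (auto simp: scalar_prod_def atLeast0LessThan)

lemma has_tt_representation_scalar_prod:
  assumes F: "univariate_space F" and d: "1 \<le> d"
  shows "has_tt_representation F d 1 (\<lambda>x. vec 1 (\<lambda>_. a \<bullet> x)) (replicate (d - 1) 2)"
proof -
  define r where "r i = (if i = 0 \<or> i = d then 1 else 2 :: nat)" for i
  \<comment> \<open>Inner cores have rows \<open>(1, a $ i * t)\<close> and \<open>(0, 1)\<close>.
    The first core keeps only the top row, the last one only the right column; for
    \<open>d = 1\<close> the single entry \<open>a $ 0 * t\<close> remains.\<close>
  define u where "u i t j k =
      (if j = 0 then if Suc i < d \<and> k = 0 then 1 else a $ i * t
       else if Suc i < d \<and> k = 0 then 0 else 1)" for i :: nat and t :: real and j k :: nat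
  \<comment> \<open>At \<open>i = d\<close> only the constant component survives, so entry 0 is 1
    there and not the empty sum.\<close>
  define e where "e x i j = (if i < d \<and> j = 0 then \<Sum>l=i..<d. a $ l * x $ l else 1)"
    for x :: "real vec" and i j :: nat
  have "has_tt_representation F d (r 0) (\<lambda>x. vec 1 (\<lambda>_. a \<bullet> x)) (map r [1..<d])"
  proof (rule has_tt_representation_backward_recursion[where u = u and e = e])
    show "(\<lambda>t. u i t j k) \<in> F" for i j k
      using univariate_space_const[OF F] univariate_space_affine[OF F, of 0 "a $ i"]
      by (cases "j = 0"; cases "Suc i < d"; cases "k = 0") (simp_all add: u_def)
    show "(\<Sum>k<r (Suc i). u i (x $ i) j k * e x (Suc i) k) = e x i j"
      if "i < d" "j < r i" for x i j
    proof (cases "Suc i < d")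
      case True
      then have "r (Suc i) = Suc (Suc 0)" by (simp add: r_def)
      with True that show ?thesis
        by (simp add: u_def e_def sum.atLeast_Suc_lessThan[of i])
    next
      case False
      with that(1) have "Suc i = d" by simp
      then show ?thesis by (auto simp: r_def u_def e_def)
    qed
    show "vec 1 (\<lambda>_. a \<bullet> x) = vec (r 0) (e x 0)" if "x \<in> carrier_vec d" for x
      using that d by (auto simp: r_def e_def scalar_prod_def)
  qed (use d in \<open>auto simp: r_def e_def\<close>)
  moreover have "map r [1..<d] = replicate (d - 1) 2"
    by (rule nth_equalityI) (auto simp: r_def)
  ultimately show ?thesis by (simp add: r_def)
qed

lemma has_tt_representation_affine:
  assumes F: "univariate_space F" and d: "1 \<le> d"
    and A: "A \<in> carrier_mat m d" and b: "b \<in> carrier_vec m"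
  shows "has_tt_representation F d m (\<lambda>x. A *\<^sub>v x + b) (map (\<lambda>i. Suc d - i) [1..<d])"
proof -
  define r where "r i = (if i = 0 then m else Suc d - i)" for i
  \<comment> \<open>All of \<open>A\<close> and \<open>b\<close> sits in core 0, whose column 0 also
    absorbs the first variable. A later core has one nonzero entry per row, in column
    \<open>j - 1\<close>: row 0 (where \<open>j - 1 = 0\<close>) copies the constant 1, row 1
    multiplies it by \<open>t\<close>, and the other rows shift the remaining coordinates.\<close>
  define u where "u i t j k =
      (if i = 0 then if k = 0 then b $ j + A $$ (j, 0) * t else A $$ (j, k)
       else if k = j - 1 then if j = 1 then t else 1 else 0)"
    for i :: nat and t :: real and j k :: nat
  define e where "e x i j =
      (if i = 0 then (A *\<^sub>v x + b) $ j else if j = 0 then 1 else x $ (i + j - 1))"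
    for x :: "real vec" and i j :: nat
  have "has_tt_representation F d (r 0) (\<lambda>x. A *\<^sub>v x + b) (map r [1..<d])"
  proof (rule has_tt_representation_backward_recursion[where u = u and e = e])
    show "(\<lambda>t. u i t j k) \<in> F" for i j k
      using univariate_space_const[OF F] univariate_space_affine[OF F]
        univariate_space_affine[OF F, of 0 1]
      by (cases "i = 0"; cases "k = 0"; cases "k = j - 1"; cases "j = 1") (simp_all add: u_def)
    show "(\<Sum>k<r (Suc i). u i (x $ i) j k * e x (Suc i) k) = e x i j"
      if x: "x \<in> carrier_vec d" and i: "i < d" and j: "j < r i" for x i j
    proof (cases "i = 0")
      case True
      \<comment> \<open>Splitting off the summand \<open>k = 0\<close> isolates the column that
        carries \<open>b $ j\<close> and \<open>x $ 0\<close>.\<close>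
      obtain d' where d': "d = Suc d'" using d by (cases d) auto
      have "(A *\<^sub>v x + b) $ j = (\<Sum>k<d. A $$ (j, k) * x $ k) + b $ j"
        using True A b x j by (auto simp: r_def scalar_prod_def atLeast0LessThan)
      then show ?thesis
        using True by (simp add: r_def u_def e_def d' sum.lessThan_Suc_shift del: sum.lessThan_Suc)
    next
      case False
      have "(\<Sum>k<r (Suc i). u i (x $ i) j k * e x (Suc i) k)
          = (\<Sum>k<r (Suc i). if k = j - 1 then (if j = 1 then x $ i else 1) * e x (Suc i) k else 0)"
        using False by (intro sum.cong) (auto simp: u_def)
      \<comment> \<open>The column \<open>j - 1\<close> is in range: \<open>j < Suc d - i\<close>
        and \<open>i < d\<close> give \<open>j - 1 < d - i\<close>, also for
        \<open>j = 0\<close>.\<close>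
      also have "\<dots> = (if j = 1 then x $ i else 1) * e x (Suc i) (j - 1)"
        using False i j by (subst sum.delta) (auto simp: r_def)
      also have "\<dots> = e x i j"
        using False by (cases "j = 0"; cases "j = 1") (simp_all add: e_def)
      finally show ?thesis .
    qed
    show "A *\<^sub>v x + b = vec (r 0) (e x 0)" for x
      using A b by (intro eq_vecI) (auto simp: r_def e_def)
  qed (use d in \<open>auto simp: r_def e_def\<close>)
  moreover have "map r [1..<d] = map (\<lambda>i. Suc d - i) [1..<d]"
    by (simp add: r_def)
  moreover have "r 0 = m"
    by (simp add: r_def)
  ultimately show ?thesis by (simp only:)
qed

theorem proposition3p2:
  fixes F :: "(real \<Rightarrow> real) set" and d :: nat
  assumes "univariate_space F" and "1 \<le> d"
  shows "(\<forall>a\<in>carrier_vec d.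
            additive_function d (\<lambda>x. a \<bullet> x) \<and>
            has_tt_representation F d 1 (\<lambda>x. vec 1 (\<lambda>_. a \<bullet> x)) (replicate (d - 1) 2)) \<and>
         (\<forall>m. \<forall>A\<in>carrier_mat m d. \<forall>b\<in>carrier_vec m.
            \<exists>rs. has_tt_representation F d m (\<lambda>x. A *\<^sub>v x + b) rs \<and> (\<forall>r\<in>set rs. r \<le> d))"
proof (intro conjI ballI allI)
  show "additive_function d (\<lambda>x. a \<bullet> x)" for a
    by (rule additive_function_scalar_prod)
  show "has_tt_representation F d 1 (\<lambda>x. vec 1 (\<lambda>_. a \<bullet> x)) (replicate (d - 1) 2)" for a
    by (rule has_tt_representation_scalar_prod[OF assms])
  fix m and A :: "real mat" and b :: "real vec"
  assume "A \<in> carrier_mat m d" and "b \<in> carrier_vec m"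
  then show "\<exists>rs. has_tt_representation F d m (\<lambda>x. A *\<^sub>v x + b) rs \<and> (\<forall>r\<in>set rs. r \<le> d)"
    by (intro exI[of _ "map (\<lambda>i. Suc d - i) [1..<d]"] conjI
        has_tt_representation_affine[OF assms]) auto
qed

end
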